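(* Let $(\mu_{i,j})_{i,j\in\mathbb{N}}$ be real skew-symmetric bi-moments with $\tau_{2n}^{(m)}\neq 0$ for all $n,m\in\mathbb{N}$, and let $\{P_n^{(m)}(z)\}_{n\in\mathbb{N}}$ be the $m$-th adjacent family of skew-orthogonal polynomials. Then for all $n,m\in\mathbb{N}$ \begin{align*} &P_{2n+1}^{(m)}(z)-\mathcal{A}^m_n P_{2n}^{(m)}(z)=z\left(P_{2n}^{(m+1)}(z)-\mathcal{B}^m_n P_{2n-2}^{(m+1)}(z)\right),\\ &P_{2n+2}^{(m)}(z)-\mathcal{C}^m_n P_{2n}^{(m)}(z)=z\left(P_{2n+1}^{(m+1)}(z)-\mathcal{D}^m_nP_{2n}^{(m+1)}(z)\right), \end{align*} with coefficients $$\mathcal{A}^m_n=\frac{P_{2n+1}^{(m)}(0)}{P_{2n}^{(m)}(0)},\quad \mathcal{B}^m_n=\frac{\tau_{2n+2}^{(m)}\tau_{2n-2}^{(m+1)}}{\tau_{2n}^{(m)}\tau_{2n}^{(m+1)}},\quad \mathcal{C}^m_n=\frac{\tau_{2n}^{(m)}\tau_{2n+2}^{(m+1)}}{\tau_{2n+2}^{(m)}\tau_{2n}^{(m+1)}},\quad \mathcal{D}^m_n=\frac{P_{2n+3}^{(m-1)}(0)}{P_{2n+2}^{(m-1)}(0)},$$ where for $m=0$ the coefficient $\mathcal{D}^0_n$ is read as $\mathrm{Pf}(0,1,\ldots,2n,2n+2)/\tau_{2n+2}^{(0)}$.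
   Context: $\mathbb{N}=\{0,1,2,\ldots\}$. The bi-moments satisfy $\mu_{i,j}=-\mu_{j,i}$ (they are $\mu_{i,j}=\langle z^i,z^j\rangle$ for a skew-symmetric bilinear form on $\mathbb{R}[z]$). Pfaffian notation: for labels $a_1,\ldots,a_{2N}$, $\mathrm{Pf}(a_1,\ldots,a_{2N})$ is the Pfaffian of the $2N\times 2N$ skew-symmetric matrix whose $(k,l)$ entry is $\mathrm{Pf}(a_k,a_l)=-\mathrm{Pf}(a_l,a_k)$; the empty Pfaffian is $1$. For integer labels $i,j$ and the label $z$, $\mathrm{Pf}(i,j)=\mu_{i,j}$ and $\mathrm{Pf}(i,z)=z^i$. Put $\tau_{2n}^{(m)}=\mathrm{Pf}(m,m+1,\ldots,m+2n-1)$ (so $\tau_0^{(m)}=1$). The $m$-th adjacent family of skew-orthogonal polynomials consists of the monic polynomials (of degree given by the subscript) $$P_{2n}^{(m)}(z)=\frac{1}{z^m\tau_{2n}^{(m)}}\mathrm{Pf}(m,\ldots,m+2n,z),\qquad P_{2n+1}^{(m)}(z)=\frac{1}{z^m\tau_{2n}^{(m)}}\mathrm{Pf}(m,\ldots,m+2n-1,m+2n+1,z).$$ In particular $P_1^{(m)}(z)=z$. Conventions: $\tau_{-2}^{(m)}=0$ and $P_{-2}^{(m)}=0$. *)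

theory Defs
  imports
    "HOL-Computational_Algebra.Polynomial"
    "HOL-Combinatorics.Permutations"
begin

text \<open>
  The Pfaffian of the \<open>2N \<times> 2N\<close> skew-symmetric matrix \<open>a\<close> (rows and columns numbered from 0) as the
  signed sum over perfect matchings. Each matching is represented by its unique permutation \<open>\<sigma>\<close> with
  \<open>\<sigma>(2i) < \<sigma>(2i+1)\<close> and \<open>\<sigma>(0) < \<sigma>(2) < \<sigma>(4) < \<dots>\<close>, which avoids the factor \<open>1/(2\<^sup>N N!)\<close> and so
  makes sense over every commutative ring.
\<close>

definition matching_perms :: "nat \<Rightarrow> (nat \<Rightarrow> nat) set" where
  "matching_perms N = {\<sigma>. \<sigma> permutes {..<2 * N} \<and>
     (\<forall>i<N. \<sigma> (2 * i) < \<sigma> (2 * i + 1)) \<and>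
     (\<forall>j<N. \<forall>i<j. \<sigma> (2 * i) < \<sigma> (2 * j))}"

definition pfaffian :: "nat \<Rightarrow> (nat \<Rightarrow> nat \<Rightarrow> 'a::comm_ring_1) \<Rightarrow> 'a" where
  "pfaffian N a = (\<Sum>\<sigma>\<in>matching_perms N. of_int (sign \<sigma>) * (\<Prod>i<N. a (\<sigma> (2 * i)) (\<sigma> (2 * i + 1))))"

text \<open>
  \<open>Pf e [a\<^sub>1, \<dots>, a\<^sub>2\<^sub>N]\<close> is \<open>Pf(a\<^sub>1, \<dots>, a\<^sub>2\<^sub>N)\<close>, where \<open>e a b\<close> is the elementary Pfaffian \<open>Pf(a, b)\<close>.
\<close>

definition Pf :: "('l \<Rightarrow> 'l \<Rightarrow> 'a::comm_ring_1) \<Rightarrow> 'l list \<Rightarrow> 'a" where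
  "Pf e xs = (if even (length xs) then pfaffian (length xs div 2) (\<lambda>k l. e (xs ! k) (xs ! l)) else 0)"

datatype label = Idx nat | Z

text \<open>
  Pfaffians involving the label \<open>z\<close> are computed in the ring of real polynomials in \<open>z\<close>.
\<close>

fun entry :: "(nat \<Rightarrow> nat \<Rightarrow> real) \<Rightarrow> label \<Rightarrow> label \<Rightarrow> real poly" where
  "entry \<mu> (Idx i) (Idx j) = [:\<mu> i j:]"
| "entry \<mu> (Idx i) Z = monom 1 i"
| "entry \<mu> Z (Idx i) = - monom 1 i"
| "entry \<mu> Z Z = 0"

text \<open>
  In \<open>\<tau> \<mu> m k\<close> and \<open>P \<mu> m k\<close> the integer \<open>k\<close> is the full subscript (so \<open>2n\<close>, not \<open>n\<close>), and both are 0 for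
  negative \<open>k\<close>. Only even subscripts of \<open>\<tau>\<close> are meaningful.
\<close>

definition \<tau> :: "(nat \<Rightarrow> nat \<Rightarrow> real) \<Rightarrow> nat \<Rightarrow> int \<Rightarrow> real" where
  "\<tau> \<mu> m k = (if k < 0 then 0 else Pf \<mu> [m..<m + nat k])"

text \<open>
  The division by \<open>z\<^sup>m\<close> is exact: expanding along the label \<open>z\<close> gives a linear combination of
  the monomials \<open>z\<^sup>i\<close> for the integer labels \<open>i\<close>, all of which are at least \<open>m\<close>.
\<close>

definition P :: "(nat \<Rightarrow> nat \<Rightarrow> real) \<Rightarrow> nat \<Rightarrow> int \<Rightarrow> real poly" where
  "P \<mu> m k = (if k < 0 then 0 else
     let n = nat k div 2;
         labels = (if even k then [m..<m + 2 * n + 1] else [m..<m + 2 * n] @ [m + 2 * n + 1])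
     in smult (1 / \<tau> \<mu> m (2 * int n)) (Pf (entry \<mu>) (map Idx labels @ [Z]) div monom 1 m))"

definition coeff_A :: "(nat \<Rightarrow> nat \<Rightarrow> real) \<Rightarrow> nat \<Rightarrow> nat \<Rightarrow> real" where
  "coeff_A \<mu> m n = poly (P \<mu> m (2 * int n + 1)) 0 / poly (P \<mu> m (2 * int n)) 0"

definition coeff_B :: "(nat \<Rightarrow> nat \<Rightarrow> real) \<Rightarrow> nat \<Rightarrow> nat \<Rightarrow> real" where
  "coeff_B \<mu> m n = (\<tau> \<mu> m (2 * int n + 2) * \<tau> \<mu> (m + 1) (2 * int n - 2)) /
                    (\<tau> \<mu> m (2 * int n) * \<tau> \<mu> (m + 1) (2 * int n))"

definition coeff_C :: "(nat \<Rightarrow> nat \<Rightarrow> real) \<Rightarrow> nat \<Rightarrow> nat \<Rightarrow> real" where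
  "coeff_C \<mu> m n = (\<tau> \<mu> m (2 * int n) * \<tau> \<mu> (m + 1) (2 * int n + 2)) /
                    (\<tau> \<mu> m (2 * int n + 2) * \<tau> \<mu> (m + 1) (2 * int n))"

definition coeff_D :: "(nat \<Rightarrow> nat \<Rightarrow> real) \<Rightarrow> nat \<Rightarrow> nat \<Rightarrow> real" where
  "coeff_D \<mu> m n =
     (if m = 0 then Pf \<mu> ([0..<2 * n + 1] @ [2 * n + 2]) / \<tau> \<mu> 0 (2 * int n + 2)
      else poly (P \<mu> (m - 1) (2 * int n + 3)) 0 / poly (P \<mu> (m - 1) (2 * int n + 2)) 0)"

end

theory Submission
  imports Defs
begin

text \<open>
  Expansion along the first label, \<open>Pf(x, B) = \<Sum>\<^sub>j \<plusminus> Pf(x, b\<^sub>j) Pf(B - b\<^sub>j)\<close>, applied to either factor turns both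
  \<open>\<Sum>\<^sub>i \<plusminus> Pf(A - a\<^sub>i) Pf(a\<^sub>i, B)\<close> and \<open>\<Sum>\<^sub>j \<plusminus> Pf(b\<^sub>j, A) Pf(B - b\<^sub>j)\<close> into the same double sum, up to a
  sign, because \<open>Pf(a\<^sub>i, b\<^sub>j) = - Pf(b\<^sub>j, a\<^sub>i)\<close>. If \<open>A\<close> and \<open>B\<close> both start with a common list \<open>S\<close>, the terms
  that pull a label out of \<open>S\<close> have a repeated label and vanish. What remains for four further labels
  are the two Pfaffian Pluecker relations, for \<open>S\<close> of odd and of even length. With
  \<open>S = (m+1, \<dots>, m+2n-1)\<close> and the labels \<open>m, m+2n, m+2n+1, z\<close> the first one is the first recurrence;
  with \<open>S = (m+1, \<dots>, m+2n)\<close> and \<open>m, m+2n+1, m+2n+2, z\<close> the second one is the second recurrence.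
\<close>

section \<open>Expansion of a Pfaffian along its first label\<close>

definition drop_nth :: "nat \<Rightarrow> 'l list \<Rightarrow> 'l list" where
  "drop_nth j xs = take j xs @ drop (Suc j) xs"

lemma length_drop_nth [simp]: "j < length xs \<Longrightarrow> length (drop_nth j xs) = length xs - 1"
  by (simp add: drop_nth_def)

lemma nth_drop_nth:
  assumes "j < length xs" "i < length xs - 1"
  shows "drop_nth j xs ! i = (if i < j then xs ! i else xs ! Suc i)"
  using assms by (auto simp: drop_nth_def nth_append min_def)

text \<open>
  The matchings that pair \<open>0\<close> with \<open>Suc j\<close> are the compositions of the following cycle with the
  matchings of the smaller size, shifted by 2.
\<close>

definition pull_cycle :: "nat \<Rightarrow> nat \<Rightarrow> nat" where
  "pull_cycle j k = (if k = 0 then 0 else if k = 1 then Suc j else if k < j + 2 then k - 1 else k)"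

text \<open>Exhibits \<open>pull_cycle j\<close> as a product of \<open>j\<close> adjacent
  transpositions, so that its range and its sign follow by induction on \<open>j\<close>.\<close>

lemma pull_cycle_Suc: "pull_cycle (Suc j) = transpose (Suc j) (Suc (Suc j)) \<circ> pull_cycle j"
  by (auto simp: pull_cycle_def transpose_def fun_eq_iff)

lemma pull_cycle_0: "pull_cycle 0 = id"
  by (auto simp: pull_cycle_def fun_eq_iff)

lemma pull_cycle_permutes: "Suc j < M \<Longrightarrow> pull_cycle j permutes {..<M}"
proof (induction j)
  case (Suc j)
  then show ?case
    unfolding pull_cycle_Suc by (intro permutes_compose permutes_swap_id) auto
qed (simp add: pull_cycle_0 permutes_id)

lemma sign_pull_cycle: "sign (pull_cycle j) = (-1) ^ j"
proof (induction j)
  case (Suc j)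
  have "permutation (pull_cycle j)"
    by (rule permutes_imp_permutation[OF _ pull_cycle_permutes[of j "j + 2"]]) auto
  with Suc show ?case
    unfolding pull_cycle_Suc by (subst sign_compose) (simp_all add: permutation_swap_id sign_swap_id)
qed (simp add: pull_cycle_0)

text \<open>Beyond the first two positions the cycle is monotone, so composing with it preserves the
  order conditions on a matching.\<close>

lemma pull_cycle_less: "2 \<le> k \<Longrightarrow> 2 \<le> l \<Longrightarrow> pull_cycle j k < pull_cycle j l \<longleftrightarrow> k < l"
  by (auto simp: pull_cycle_def)

lemma pull_cycle_pos: "0 < k \<Longrightarrow> 0 < pull_cycle j k"
  by (auto simp: pull_cycle_def)

text \<open>The conjugate of a permutation by \<open>i + 2\<close>, extended by the identity;
  positions 0 and 1 stay free for the first pair.\<close>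

definition shift_perm :: "nat \<Rightarrow> (nat \<Rightarrow> nat) \<Rightarrow> nat \<Rightarrow> nat" where
  "shift_perm N = map_permutation {..<2 * N} (\<lambda>i. i + 2)"

lemma bij_betw_shift: "bij_betw (\<lambda>i. i + 2) {..<2 * N} {2..<2 * Suc N}"
  by (rule bij_betw_byWitness[where f' = "\<lambda>i. i - 2"]) auto

lemma shift_perm_permutes: "\<sigma> permutes {..<2 * N} \<Longrightarrow> shift_perm N \<sigma> permutes {2..<2 * Suc N}"
  unfolding shift_perm_def by (rule map_permutation_permutes[OF bij_betw_shift])

lemma sign_shift_perm: "\<sigma> permutes {..<2 * N} \<Longrightarrow> sign (shift_perm N \<sigma>) = sign \<sigma>"
  unfolding shift_perm_def by (intro sign_map_permutation) (auto simp: inj_on_def)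

lemma shift_perm_apply: "i < 2 * N \<Longrightarrow> shift_perm N \<sigma> (Suc (Suc i)) = Suc (Suc (\<sigma> i))"
  using map_permutation_apply[of "\<lambda>i. i + 2" "{..<2 * N}" i \<sigma>] by (simp add: shift_perm_def inj_on_def)

lemma shift_perm_inverse:
  assumes "\<rho> permutes {2..<2 * Suc N}"
  obtains \<sigma> where "\<sigma> permutes {..<2 * N}" "shift_perm N \<sigma> = \<rho>"
proof
  have b: "bij_betw (\<lambda>i. i - 2) {2..<2 * Suc N} {..<2 * N}"
    by (rule bij_betw_byWitness[where f' = "\<lambda>i. i + 2"]) auto
  show "map_permutation {2..<2 * Suc N} (\<lambda>i. i - 2) \<rho> permutes {..<2 * N}"
    by (rule map_permutation_permutes[OF b assms])
  show "shift_perm N (map_permutation {2..<2 * Suc N} (\<lambda>i. i - 2) \<rho>) = \<rho>"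
    unfolding shift_perm_def
    by (rule map_permutation_compose_inv[OF b assms]) auto
qed

text \<open>The position of the value 0 cannot be odd, since its even partner has a smaller value,
  nor even and positive, since position 0 has a smaller value.\<close>

lemma matching_perms_0:
  assumes "\<sigma> \<in> matching_perms (Suc N)"
  shows "\<sigma> 0 = 0"
proof -
  have p: "\<sigma> permutes {..<2 * Suc N}" 
    and 1: "\<And>i. i < Suc N \<Longrightarrow> \<sigma> (2 * i) < \<sigma> (2 * i + 1)"
    and 2: "\<And>i j. j < Suc N \<Longrightarrow> i < j \<Longrightarrow> \<sigma> (2 * i) < \<sigma> (2 * j)"
    using assms by (auto simp: matching_perms_def)
  obtain k where k: "\<sigma> k = 0" "k < 2 * Suc N"
    using permutes_image[OF p] by (metis imageE lessThan_iff mult_pos_pos zero_less_Suc zero_less_numeral)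
  show ?thesis
  proof (cases "even k")
    case True
    then show ?thesis using 2[of "k div 2" 0] k by (cases "k = 0") auto
  next
    case False
    then obtain i where "k = 2 * i + 1" by (elim oddE)
    then show ?thesis using 1[of i] k by auto
  qed
qed

lemma pull_shift_apply:
  assumes "\<sigma> permutes {..<2 * N}"
  shows "(pull_cycle j \<circ> shift_perm N \<sigma>) 0 = 0" 
    and "(pull_cycle j \<circ> shift_perm N \<sigma>) (Suc 0) = Suc j"
    and "i < 2 * N \<Longrightarrow> (pull_cycle j \<circ> shift_perm N \<sigma>) (Suc (Suc i)) = pull_cycle j (Suc (Suc (\<sigma> i)))"
  using permutes_not_in[OF shift_perm_permutes[OF assms], of 0]
    permutes_not_in[OF shift_perm_permutes[OF assms], of 1]
  by (auto simp: pull_cycle_def shift_perm_apply)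

text \<open>The composition starts with \<open>0, Suc j\<close> and all its later values are
  positive, so the conditions involving the first pair hold automatically. By monotonicity of the
  cycle the others are those for \<open>\<sigma>\<close>.\<close>

lemma pull_shift_mem:
  assumes \<sigma>: "\<sigma> permutes {..<2 * N}" and j: "j < 2 * N + 1"
  shows "pull_cycle j \<circ> shift_perm N \<sigma> \<in> matching_perms (Suc N) \<longleftrightarrow> \<sigma> \<in> matching_perms N"
proof -
  let ?\<rho> = "pull_cycle j \<circ> shift_perm N \<sigma>"
  have app': "?\<rho> 0 = 0" "?\<rho> (Suc 0) = Suc j"
    "\<And>i. i < N \<Longrightarrow> ?\<rho> (2 * Suc i) = pull_cycle j (Suc (Suc (\<sigma> (2 * i))))"
    "\<And>i. i < N \<Longrightarrow> ?\<rho> (Suc (2 * Suc i)) = pull_cycle j (Suc (Suc (\<sigma> (Suc (2 * i)))))"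
    using pull_shift_apply[OF \<sigma>] by auto
  have p: "?\<rho> permutes {..<2 * Suc N}"
    using shift_perm_permutes[OF \<sigma>] pull_cycle_permutes[of j "2 * Suc N"] j
    by (intro permutes_compose) (auto elim: permutes_subset)
  have 1: "(\<forall>i<Suc N. ?\<rho> (2 * i) < ?\<rho> (2 * i + 1)) \<longleftrightarrow> (\<forall>i<N. \<sigma> (2 * i) < \<sigma> (2 * i + 1))"
    unfolding All_less_Suc2 using app' by (simp add: pull_cycle_less del: mult_Suc_right comp_apply)
  have 2: "(\<forall>l<Suc N. \<forall>i<l. ?\<rho> (2 * i) < ?\<rho> (2 * l)) \<longleftrightarrow> (\<forall>l<N. \<forall>i<l. \<sigma> (2 * i) < \<sigma> (2 * l))"
    unfolding All_less_Suc2 using app'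
    by (simp add: pull_cycle_less pull_cycle_pos del: mult_Suc_right comp_apply)
  show ?thesis using p \<sigma> 1 2 by (simp add: matching_perms_def)
qed

text \<open>A matching is given by the partner \<open>Suc j\<close> of 0 and a matching of the
  remaining points. The index \<open>j\<close> is read off at position 1, after which the cycle can
  be cancelled.\<close>

lemma bij_betw_matching_perms_Suc:
  "bij_betw (\<lambda>(j, \<sigma>). pull_cycle j \<circ> shift_perm N \<sigma>)
     ({..<2 * N + 1} \<times> matching_perms N) (matching_perms (Suc N))"
proof (rule bij_betw_imageI)
  show "inj_on (\<lambda>(j, \<sigma>). pull_cycle j \<circ> shift_perm N \<sigma>) ({..<2 * N + 1} \<times> matching_perms N)"
  proof (rule inj_onI, clarify)
    fix j \<sigma> j' \<sigma>'
    assume s: "\<sigma> \<in> matching_perms N" "\<sigma>' \<in> matching_perms N"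
      and eq: "pull_cycle j \<circ> shift_perm N \<sigma> = pull_cycle j' \<circ> shift_perm N \<sigma>'"
    have p: "\<sigma> permutes {..<2 * N}" "\<sigma>' permutes {..<2 * N}"
      using s by (auto simp: matching_perms_def)
    have j: "j = j'"
      using fun_cong[OF eq, of "Suc 0"] p by (simp add: pull_shift_apply del: comp_apply)
    have "inj (pull_cycle j)"
      using pull_cycle_permutes[of j "j + 2"] permutes_inj by auto
    then have sh: "shift_perm N \<sigma> k = shift_perm N \<sigma>' k" for k
      using fun_cong[OF eq, of k] j by (simp add: inj_eq)
    have "\<sigma> = \<sigma>'"
    proof
      fix i
      show "\<sigma> i = \<sigma>' i"
      proof (cases "i < 2 * N")
        case True
        then show ?thesis using sh[of "Suc (Suc i)"] by (simp add: shift_perm_apply)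
      next
        case False
        then show ?thesis using p by (simp add: permutes_not_in)
      qed
    qed
    with j show "j = j' \<and> \<sigma> = \<sigma>'" by simp
  qed
next
  show "(\<lambda>(j, \<sigma>). pull_cycle j \<circ> shift_perm N \<sigma>) ` ({..<2 * N + 1} \<times> matching_perms N) =
    matching_perms (Suc N)" (is "?f ` ?A = _")
  proof (intro equalityI subsetI)
    fix \<rho> assume "\<rho> \<in> ?f ` ?A"
    then show "\<rho> \<in> matching_perms (Suc N)"
      using pull_shift_mem by (auto simp: matching_perms_def[of N])
  next
    fix \<rho> assume \<rho>: "\<rho> \<in> matching_perms (Suc N)"
    then have p: "\<rho> permutes {..<2 * Suc N}" by (simp add: matching_perms_def)
    have r0: "\<rho> 0 = 0" using \<rho> by (rule matching_perms_0)
    define j where "j = \<rho> 1 - 1"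
    have "\<rho> 1 < 2 * Suc N" using permutes_in_image[OF p, of 1] by simp
    moreover have "0 < \<rho> 1" using \<rho> r0 by (force simp: matching_perms_def)
    ultimately have j: "\<rho> 1 = Suc j" "j < 2 * N + 1" by (auto simp: j_def)
    \<comment> \<open>Undoing the cycle leaves a permutation that fixes 0 and 1, hence a shifted
      one.\<close>
    define \<pi> where "\<pi> = inv (pull_cycle j) \<circ> \<rho>"
    have c: "pull_cycle j permutes {..<2 * Suc N}" using j by (intro pull_cycle_permutes) simp
    have \<rho>_eq: "\<rho> = pull_cycle j \<circ> \<pi>"
      using permutes_inv_o(1)[OF c] by (simp add: \<pi>_def o_assoc)
    have \<pi>: "\<pi> permutes {..<2 * Suc N}"
      unfolding \<pi>_def by (intro permutes_compose permutes_inv c p)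
    have "\<pi> 0 = 0" "\<pi> 1 = 1"
      using r0 j permutes_inv_eq[OF c] by (auto simp: \<pi>_def pull_cycle_def)
    then have "\<pi> permutes {2..<2 * Suc N}"
      by (intro permutes_superset[OF \<pi>]) (auto simp: numeral_2_eq_2 not_le less_Suc_eq)
    then obtain \<sigma> where \<sigma>: "\<sigma> permutes {..<2 * N}" "shift_perm N \<sigma> = \<pi>"
      by (rule shift_perm_inverse)
    have "\<sigma> \<in> matching_perms N"
      using pull_shift_mem[OF \<sigma>(1) j(2)] \<rho> \<sigma>(2) \<rho>_eq by simp
    then show "\<rho> \<in> ?f ` ?A"
      using \<sigma>(2) \<rho>_eq j(2) by (auto intro!: image_eqI[of _ _ "(j, \<sigma>)"])
  qed
qed

text \<open>The sign \<open>(-1) ^ j\<close> is that of the cycle. The map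
  \<open>pull_cycle j (k + 2)\<close> lists the indices other than 0 and \<open>Suc j\<close> in
  increasing order, so the inner Pfaffian is that of the matrix with these two rows and columns
  removed.\<close>

lemma pfaffian_Suc:
  "pfaffian (Suc N) a = (\<Sum>j<2 * N + 1. (-1) ^ j * a 0 (Suc j) *
     pfaffian N (\<lambda>k l. a (pull_cycle j (k + 2)) (pull_cycle j (l + 2))))"
proof -
  let ?t = "\<lambda>\<rho>. of_int (sign \<rho>) * (\<Prod>i<Suc N. a (\<rho> (2 * i)) (\<rho> (2 * i + 1)))"
  have "pfaffian (Suc N) a =
     (\<Sum>(j, \<sigma>) \<in> {..<2 * N + 1} \<times> matching_perms N. ?t (pull_cycle j \<circ> shift_perm N \<sigma>))"
    using sum.reindex_bij_betw[OF bij_betw_matching_perms_Suc, of ?t N]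
    by (simp only: pfaffian_def case_prod_unfold)
  also have "\<dots> = (\<Sum>j<2 * N + 1. \<Sum>\<sigma>\<in>matching_perms N. ?t (pull_cycle j \<circ> shift_perm N \<sigma>))"
    by (simp add: sum.cartesian_product)
  also have "\<dots> = (\<Sum>j<2 * N + 1. \<Sum>\<sigma>\<in>matching_perms N. (-1) ^ j * a 0 (Suc j) * (of_int (sign \<sigma>) *
      (\<Prod>i<N. a (pull_cycle j (\<sigma> (2 * i) + 2)) (pull_cycle j (\<sigma> (2 * i + 1) + 2)))))"
  proof (intro sum.cong refl)
    fix j \<sigma> assume j: "j \<in> {..<2 * N + 1}" and "\<sigma> \<in> matching_perms N"
    then have p: "\<sigma> permutes {..<2 * N}" by (simp add: matching_perms_def)
    have "permutation (pull_cycle j)" "permutation (shift_perm N \<sigma>)"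
      using pull_cycle_permutes[of j "j + 2"] shift_perm_permutes[OF p] permutation_permutes by auto
    then have "sign (pull_cycle j \<circ> shift_perm N \<sigma>) = (-1) ^ j * sign \<sigma>"
      by (simp add: sign_compose sign_pull_cycle sign_shift_perm[OF p])
    moreover have "(\<Prod>i<N. a ((pull_cycle j \<circ> shift_perm N \<sigma>) (2 * Suc i))
        ((pull_cycle j \<circ> shift_perm N \<sigma>) (2 * Suc i + 1))) =
      (\<Prod>i<N. a (pull_cycle j (\<sigma> (2 * i) + 2)) (pull_cycle j (\<sigma> (2 * i + 1) + 2)))"
      using pull_shift_apply(3)[OF p] by (intro prod.cong refl) simp
    ultimately show "?t (pull_cycle j \<circ> shift_perm N \<sigma>) =
       (-1) ^ j * a 0 (Suc j) * (of_int (sign \<sigma>) *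
      (\<Prod>i<N. a (pull_cycle j (\<sigma> (2 * i) + 2)) (pull_cycle j (\<sigma> (2 * i + 1) + 2))))"
      using pull_shift_apply(1,2)[OF p, of j]
      by (simp add: prod.lessThan_Suc_shift mult.assoc mult.left_commute del: comp_apply prod.lessThan_Suc)
  qed
  also have "\<dots> = (\<Sum>j<2 * N + 1. (-1) ^ j * a 0 (Suc j) *
     pfaffian N (\<lambda>k l. a (pull_cycle j (k + 2)) (pull_cycle j (l + 2))))"
    by (simp add: pfaffian_def sum_distrib_left)
  finally show ?thesis .
qed

lemma pfaffian_cong:
  assumes "\<And>k l. k < 2 * N \<Longrightarrow> l < 2 * N \<Longrightarrow> a k l = b k l"
  shows "pfaffian N a = pfaffian N b"
  unfolding pfaffian_def
proof (intro sum.cong prod.cong refl arg_cong2[where f = "(*)"])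
  fix \<sigma> i assume "\<sigma> \<in> matching_perms N" "i \<in> {..<N}"
  then show "a (\<sigma> (2 * i)) (\<sigma> (2 * i + 1)) = b (\<sigma> (2 * i)) (\<sigma> (2 * i + 1))"
    using permutes_in_image[of \<sigma> "{..<2 * N}"] by (intro assms) (auto simp: matching_perms_def)
qed

lemma Pf_Nil [simp]: "Pf e [] = 1"
proof -
  have "matching_perms 0 = {id}" by (auto simp: matching_perms_def permutes_empty)
  then show ?thesis by (simp add: Pf_def pfaffian_def)
qed

text \<open>Holds for both parities: if \<open>xs\<close> has even length, both sides are 0 by the
  convention for lists of odd length. Later expansions thus need no condition on lengths.\<close>

lemma Pf_Cons:
  "Pf e (x # xs) = (\<Sum>j<length xs. (-1) ^ j * e x (xs ! j) * Pf e (drop_nth j xs))"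
proof (cases "even (length xs)")
  case True
  then have "odd (length (drop_nth j xs))" if "j < length xs" for j
    using that by (cases xs) auto
  with True show ?thesis by (simp add: Pf_def)
next
  case False
  then obtain N where N: "length xs = 2 * N + 1" by (elim oddE)
  have *: "Pf e (drop_nth j xs) = pfaffian N (\<lambda>k l. e ((x # xs) ! pull_cycle j (k + 2)) ((x # xs) ! pull_cycle j (l + 2)))"
    if "j < length xs" for j
    using that N by (auto simp: Pf_def nth_drop_nth pull_cycle_def intro!: pfaffian_cong)
  have "Pf e (x # xs) = pfaffian (Suc N) (\<lambda>k l. e ((x # xs) ! k) ((x # xs) ! l))"
    by (simp add: Pf_def N)
  also have "\<dots> = (\<Sum>j<length xs. (-1) ^ j * e x (xs ! j) * Pf e (drop_nth j xs))"
    unfolding pfaffian_Suc N[symmetric] by (intro sum.cong refl) (simp add: *)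
  finally show ?thesis .
qed

section \<open>Antisymmetry of the Pfaffian in its labels\<close>

lemma drop_nth_append:
  "drop_nth j (xs @ ys) = (if j < length xs then drop_nth j xs @ ys else xs @ drop_nth (j - length xs) ys)"
  by (auto simp: drop_nth_def Suc_diff_le)

lemma drop_nth_Cons:
  "drop_nth j (x # xs) = (if j = 0 then xs else x # drop_nth (j - 1) xs)"
  by (cases j) (auto simp: drop_nth_def)

lemma drop_nth_drop_nth:
  assumes "j < i" "i < length xs"
  shows "drop_nth j (drop_nth i xs) = drop_nth (i - 1) (drop_nth j xs)"
  by (rule nth_equalityI) (use assms in \<open>auto simp: nth_drop_nth\<close>)

text \<open>Expansion along both leading labels. The double sum runs over ordered pairs of distinct
  positions of \<open>xs\<close>, with \<open>j\<close> counted after the removal of position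
  \<open>i\<close>; in this form the effect of exchanging \<open>a\<close> and \<open>b\<close> can
  be compared term by term.\<close>

lemma Pf_Cons_Cons:
  "Pf e (a # b # xs) = e a b * Pf e xs - (\<Sum>(i, j) \<in> {..<length xs} \<times> {..<length xs - 1}.
     (-1) ^ (i + j) * e a (xs ! i) * e b (drop_nth i xs ! j) * Pf e (drop_nth j (drop_nth i xs)))"
proof -
  have "Pf e (a # b # xs) = e a b * Pf e xs - 
     (\<Sum>i<length xs. (-1) ^ i * e a (xs ! i) * Pf e (b # drop_nth i xs))"
    by (subst Pf_Cons) (simp add: sum.lessThan_Suc_shift drop_nth_Cons sum_negf del: sum.lessThan_Suc)
  also have "(\<Sum>i<length xs. (-1) ^ i * e a (xs ! i) * Pf e (b # drop_nth i xs)) =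
    (\<Sum>i<length xs. \<Sum>j<length xs - 1.
     (-1) ^ (i + j) * e a (xs ! i) * e b (drop_nth i xs ! j) * Pf e (drop_nth j (drop_nth i xs)))"
    by (intro sum.cong refl)
      (simp add: Pf_Cons sum_distrib_left power_add mult.assoc mult.left_commute)
  finally show ?thesis by (simp add: sum.cartesian_product)
qed

context
  fixes e :: "'l \<Rightarrow> 'l \<Rightarrow> 'a::comm_ring_1"
  assumes skew: "\<And>x y. e x y = - e y x"
begin

lemma Pf_swap_first: "Pf e (a # b # xs) = - Pf e (b # a # xs)"
proof -
  define t where "t = (\<lambda>a b (i, j). (-1) ^ (i + j) * e a (xs ! i) * e b (drop_nth i xs ! j) *
     Pf e (drop_nth j (drop_nth i xs)))"
  \<comment> \<open>This involution encodes the same two removed positions in the opposite order. It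
    changes \<open>i + j\<close> by one, which gives the sign.\<close>
  define w where "w = (\<lambda>(i, j). if j < i then (j, i - 1) else (Suc j, i :: nat))"
  let ?I = "{..<length xs} \<times> {..<length xs - 1}"
  have tw: "t b a (w p) = - t a b p" if "p \<in> ?I" for p
  proof (cases p)
    case (Pair i j)
    show ?thesis
    proof (cases "j < i")
      case True
      then obtain i' where i': "i = Suc i'" by (cases i) auto
      then have "drop_nth j (drop_nth i xs) = drop_nth i' (drop_nth j xs)"
        using drop_nth_drop_nth[OF True, of xs] that Pair by simp
      then show ?thesis
        using True that Pair i' by (auto simp: t_def w_def nth_drop_nth algebra_simps)
    next
      case False
      then have "drop_nth i (drop_nth (Suc j) xs) = drop_nth j (drop_nth i xs)"
        using drop_nth_drop_nth[of i "Suc j" xs] that Pair by auto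
      then show ?thesis
        using False that Pair by (auto simp: t_def w_def nth_drop_nth algebra_simps)
    qed
  qed
  have "(\<Sum>p\<in>?I. - t a b p) = (\<Sum>p\<in>?I. t b a p)"
    by (rule sum.reindex_bij_witness[where i = w and j = w]) (auto simp: w_def tw[unfolded w_def])
  then show ?thesis
    using skew[of a b] by (simp add: Pf_Cons_Cons t_def sum_negf)
qed

text \<open>Induction on the length of the prefix, not on its structure, because the expansion along
  its first label may strike a label from the middle of the rest.\<close>

lemma Pf_swap_adjacent: "Pf e (xs @ a # b # ys) = - Pf e (xs @ b # a # ys)"
proof (induction xs arbitrary: ys rule: length_induct)
  case (1 xs)
  show ?case
  proof (cases xs)
    case Nil
    then show ?thesis using Pf_swap_first[of a b ys] by (simp only: append_Nil)
  next
    case (Cons x zs)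
    define n where n: "n = length zs"
    have IH: "Pf e (us @ a # b # vs) = - Pf e (us @ b # a # vs)" if "length us \<le> n" for us vs
      using 1[rule_format, of us vs] that Cons n by simp
    let ?L = "\<lambda>a b. zs @ a # b # ys"
    let ?I = "{..<Suc (Suc (n + length ys))}"
    let ?t = "\<lambda>a b j. (-1) ^ j * e x (?L a b ! j) * Pf e (drop_nth j (?L a b))"
    \<comment> \<open>The terms that strike \<open>a\<close> and \<open>b\<close> are exchanged;
      they sit at adjacent positions and so carry opposite signs. All other terms change sign by the
      induction hypothesis.\<close>
    let ?w = "transpose n (Suc n)"
    have tw: "?t b a (?w j) = - ?t a b j" if "j \<in> ?I" for j
    proof -
      consider "j < n" | "j = n" | "j = Suc n" | "Suc n < j" by linarith
      then show ?thesis
      proof cases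
        case 1
        then have "Pf e (drop_nth j zs @ a # b # ys) = - Pf e (drop_nth j zs @ b # a # ys)"
          using n by (intro IH) simp
        with 1 n show ?thesis by (simp add: drop_nth_append nth_append)
      next
        case 2
        then show ?thesis using n by (simp add: drop_nth_append drop_nth_Cons nth_append)
      next
        case 3
        then show ?thesis using n by (simp add: drop_nth_append drop_nth_Cons nth_append)
      next
        case 4
        then obtain k where k: "j = Suc (Suc (n + k))" using less_iff_Suc_add by auto
        have "Pf e (zs @ a # b # drop_nth k ys) = - Pf e (zs @ b # a # drop_nth k ys)"
          using n by (intro IH) simp
        then show ?thesis using n k by (simp add: drop_nth_append drop_nth_Cons nth_append)
      qed
    qed
    have "(\<Sum>j\<in>?I. - ?t a b j) = (\<Sum>j\<in>?I. ?t b a j)"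
      by (rule sum.reindex_bij_witness[where i = ?w and j = ?w])
        (use tw in \<open>auto simp: transpose_def split: if_splits\<close>)
    then have "(\<Sum>j\<in>?I. ?t a b j) = - (\<Sum>j\<in>?I. ?t b a j)"
      by (subst equation_minus_iff) (simp only: sum_negf)
    then show ?thesis by (simp add: Cons n Pf_Cons del: sum.lessThan_Suc)
  qed
qed

lemma Pf_move: "Pf e (xs @ a # ys @ zs) = (-1) ^ length ys * Pf e (xs @ ys @ a # zs)"
proof (induction ys arbitrary: xs)
  case (Cons y ys)
  have "Pf e (xs @ a # (y # ys) @ zs) = - Pf e ((xs @ [y]) @ a # ys @ zs)"
    using Pf_swap_adjacent[of xs a y "ys @ zs"] by simp
  then show ?case by (simp only: Cons) simp
qed simp

lemma Pf_move_front: "Pf e (a # S @ T) = (-1) ^ length S * Pf e (S @ a # T)"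
  using Pf_move[of "[]" a S T] by simp

section \<open>Pfaffian Pluecker relations\<close>

lemma Pf_bilinear:
  "(\<Sum>i<length A. (-1) ^ i * Pf e (drop_nth i A) * Pf e (A ! i # B)) +
   (\<Sum>j<length B. (-1) ^ j * Pf e (drop_nth j B) * Pf e (B ! j # A)) = 0"
proof -
  have 1: "(\<Sum>i<length A. (-1) ^ i * Pf e (drop_nth i A) * Pf e (A ! i # B)) =
    (\<Sum>i<length A. \<Sum>j<length B. (-1) ^ (i + j) * e (A ! i) (B ! j) * Pf e (drop_nth i A) * Pf e (drop_nth j B))"
    by (intro sum.cong refl)
      (simp add: Pf_Cons sum_distrib_left power_add mult.assoc mult.left_commute)
  have "(\<Sum>j<length B. (-1) ^ j * Pf e (drop_nth j B) * Pf e (B ! j # A)) =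
    (\<Sum>j<length B. \<Sum>i<length A. - ((-1) ^ (i + j) * e (A ! i) (B ! j) * Pf e (drop_nth i A) * Pf e (drop_nth j B)))"
  proof (intro sum.cong refl)
    fix j
    show "(-1) ^ j * Pf e (drop_nth j B) * Pf e (B ! j # A) = 
    (\<Sum>i<length A. - ((-1) ^ (i + j) * e (A ! i) (B ! j) * Pf e (drop_nth i A) * Pf e (drop_nth j B)))"
      unfolding Pf_Cons sum_distrib_left sum_distrib_right
      by (intro sum.cong refl) (simp add: skew[of "B ! j"] power_add mult_ac)
  qed
  also have "\<dots> = - (\<Sum>i<length A. \<Sum>j<length B. (-1) ^ (i + j) * e (A ! i) (B ! j) * Pf e (drop_nth i A) * Pf e (drop_nth j B))"
    by (subst sum.swap) (simp add: sum_negf)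
  finally show ?thesis using 1 by simp
qed

end

context
  fixes e :: "'l \<Rightarrow> 'l \<Rightarrow> 'a::{idom, ring_char_0}"
  assumes skew: "\<And>x y. e x y = - e y x"
begin

text \<open>Once the equal labels are adjacent, exchanging them shows that the Pfaffian is its own
  negative; the class constraints of this context allow the factor 2 to be cancelled.\<close>

lemma Pf_repeated:
  assumes "x \<in> set xs"
  shows "Pf e (x # xs @ ys) = 0"
proof -
  obtain us vs where xs: "xs = us @ x # vs" using assms split_list by fastforce
  have "Pf e (us @ x # x # vs @ ys) = - Pf e (us @ x # x # vs @ ys)"
    by (rule Pf_swap_adjacent[OF skew])
  then have "2 * Pf e (us @ x # x # vs @ ys) = 0"
    unfolding mult_2 by (metis add.right_inverse)
  then have "Pf e (us @ x # x # vs @ ys) = 0" by simp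
  with Pf_move_front[where e = e, OF skew, of x us "x # vs @ ys"] show ?thesis
    by (simp add: xs)
qed

lemma Pf_Pluecker:
  "(\<Sum>i<length A. (-1) ^ i * Pf e (S @ drop_nth i A) * Pf e (S @ A ! i # B)) +
   (\<Sum>j<length B. (-1) ^ j * Pf e (S @ drop_nth j B) * Pf e (S @ B ! j # A)) = 0"
proof -
  have split: "(\<Sum>i<length S + n. f i) = (\<Sum>i<n. f (length S + i))"
    if "\<And>i. i < length S \<Longrightarrow> f i = 0" for f :: "nat \<Rightarrow> 'a" and n
  proof -
    have "(\<Sum>i<n. f (length S + i)) = (\<Sum>i=length S..<length S + n. f i)"
      by (rule sum.reindex_bij_witness[where i = "\<lambda>i. i - length S" and j = "\<lambda>i. length S + i"]) auto
    also have "\<dots> = (\<Sum>i<length S + n. f i)"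
      by (rule sum.mono_neutral_left) (auto simp: that)
    finally show ?thesis ..
  qed
  have zero: "Pf e (S ! i # S @ ys) = 0" if "i < length S" for i ys
    using that by (intro Pf_repeated) simp
  have half: "(\<Sum>i<length (S @ A). (-1) ^ i * Pf e (drop_nth i (S @ A)) * Pf e ((S @ A) ! i # S @ B)) =
    (\<Sum>i<length A. (-1) ^ i * Pf e (S @ drop_nth i A) * Pf e (S @ A ! i # B))" for A B
  proof -
    have "(\<Sum>i<length (S @ A). (-1) ^ i * Pf e (drop_nth i (S @ A)) * Pf e ((S @ A) ! i # S @ B)) =
      (\<Sum>i<length A. (-1) ^ (length S + i) * Pf e (S @ drop_nth i A) * Pf e (A ! i # S @ B))"
      unfolding length_append by (subst split) (simp_all add: nth_append zero drop_nth_append)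
    \<comment> \<open>The sign \<open>(-1) ^ length S\<close> from the position of
      \<open>A ! i\<close> in \<open>S @ A\<close> cancels against the sign from moving that label
      behind \<open>S\<close>.\<close>
    also have "\<dots> = (\<Sum>i<length A. (-1) ^ i * Pf e (S @ drop_nth i A) * Pf e (S @ A ! i # B))"
      unfolding Pf_move_front[where e = e, OF skew] by (intro sum.cong refl) (simp add: power_add)
    finally show ?thesis .
  qed
  show ?thesis
    using Pf_bilinear[where e = e, OF skew, where A = "S @ A" and B = "S @ B"]
    by (simp only: half)
qed

text \<open>With the labels divided 2 + 2, one or three of them follow \<open>S\<close> in each
  factor, so the relation is nontrivial only for \<open>S\<close> of odd length.\<close>

lemma Pf_Pluecker_2_2:
  "Pf e (S @ [b]) * Pf e (S @ [a, c, d]) - Pf e (S @ [a]) * Pf e (S @ [b, c, d])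
   + (Pf e (S @ [d]) * Pf e (S @ [c, a, b]) - Pf e (S @ [c]) * Pf e (S @ [d, a, b])) = 0"
  using Pf_Pluecker[where A = "[a, b]" and S = S and B = "[c, d]"]
  by (simp add: drop_nth_Cons)

text \<open>With the labels divided 1 + 3, an even number of them follows \<open>S\<close> in each
  factor, so the relation is nontrivial only for \<open>S\<close> of even length.\<close>

lemma Pf_Pluecker_1_3:
  "Pf e S * Pf e (S @ [a, b, c, d]) + (Pf e (S @ [c, d]) * Pf e (S @ [b, a])
   - Pf e (S @ [b, d]) * Pf e (S @ [c, a]) + Pf e (S @ [b, c]) * Pf e (S @ [d, a])) = 0"
  using Pf_Pluecker[where A = "[a]" and S = S and B = "[b, c, d]"]
  by (simp add: drop_nth_Cons numeral_eq_Suc)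

lemma Pf_rotate_3: "Pf e (S @ [c, a, b]) = Pf e (S @ [a, b, c])"
  using Pf_move[where e = e, OF skew, where xs = S and a = c and ys = "[a, b]" and zs = "[]"] by simp

text \<open>Puts \<open>a\<close> in front of \<open>S\<close>, where the smallest label
  \<open>m\<close> stands in the recurrence. Each product contains \<open>a\<close> in exactly one
  factor, so moving it across \<open>S\<close> changes all signs alike.\<close>

lemma Pf_identity_odd:
  assumes "odd (length S)"
  shows "Pf e (S @ [b]) * Pf e (a # S @ [c, d]) - Pf e (S @ [c]) * Pf e (a # S @ [b, d])
    = Pf e (a # S) * Pf e (S @ [b, c, d]) - Pf e (a # S @ [b, c]) * Pf e (S @ [d])"
  using Pf_Pluecker_2_2[of S b a c d] Pf_move_front[where e = e, OF skew, of a S "[]"] assms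
    Pf_rotate_3[of S c a b] Pf_rotate_3[of S d a b] Pf_move_front[where e = e, OF skew, of a S "[c, d]"]
    Pf_move_front[where e = e, OF skew, of a S "[b, c]"] Pf_move_front[where e = e, OF skew, of a S "[b, d]"]
  by (simp add: algebra_simps)

text \<open>Moving \<open>a\<close> across \<open>S\<close> costs no sign here; the minus signs come
  from first exchanging it with \<open>b\<close>, \<open>c\<close> or \<open>d\<close>.\<close>

lemma Pf_identity_even:
  assumes "even (length S)"
  shows "Pf e S * Pf e (a # S @ [b, c, d]) - Pf e (a # S @ [d]) * Pf e (S @ [b, c])
    = Pf e (a # S @ [b]) * Pf e (S @ [c, d]) - Pf e (a # S @ [c]) * Pf e (S @ [b, d])"
  using Pf_Pluecker_1_3[of S a b c d] assms
    Pf_swap_adjacent[where e = e, OF skew, of S b a "[]"]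
    Pf_swap_adjacent[where e = e, OF skew, of S c a "[]"]
    Pf_swap_adjacent[where e = e, OF skew, of S d a "[]"]
    Pf_move_front[where e = e, OF skew, of a S "[b]"] Pf_move_front[where e = e, OF skew, of a S "[c]"] Pf_move_front[where e = e, OF skew, of a S "[d]"]
    Pf_move_front[where e = e, OF skew, of a S "[b, c, d]"]
  by (simp add: algebra_simps)

end

section \<open>Pfaffians with the label \<open>z\<close> as polynomials\<close>

lemma drop_nth_map: "drop_nth j (map f xs) = map f (drop_nth j xs)"
  by (simp add: drop_nth_def take_map drop_map)

lemma minus_one_power_poly: "(-1) ^ j = [:(-1) ^ j :: 'a::comm_ring_1:]"
  by (induction j) (simp_all add: one_pCons)

text \<open>Turns the factors without \<open>z\<close> in the polynomial Pluecker relations into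
  real scalars.\<close>

lemma Pf_entry_Idx: "Pf (entry \<mu>) (map Idx xs) = [:Pf \<mu> xs:]"
proof (induction xs rule: length_induct)
  case (1 xs)
  have const_sum: "(\<Sum>j\<in>J. [:f j:]) = [:\<Sum>j\<in>J. f j:]" if "finite J" for f :: "nat \<Rightarrow> real" and J
    using that by induction auto
  show ?case
  proof (cases xs)
    case (Cons x ys)
    have "(-1) ^ j * entry \<mu> (Idx x) (map Idx ys ! j) * Pf (entry \<mu>) (drop_nth j (map Idx ys)) =
      [:(-1) ^ j * \<mu> x (ys ! j) * Pf \<mu> (drop_nth j ys):]" if "j < length ys" for j
    proof -
      have "Pf (entry \<mu>) (map Idx (drop_nth j ys)) = [:Pf \<mu> (drop_nth j ys):]"
        using 1[rule_format, of "drop_nth j ys"] that Cons by simp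
      then show ?thesis
        using that by (simp add: drop_nth_map minus_one_power_poly)
    qed
    then show ?thesis by (simp add: Cons Pf_Cons const_sum)
  qed (simp add: one_pCons)
qed

lemma entry_skew:
  assumes "\<And>i j. \<mu> i j = - \<mu> j i"
  shows "entry \<mu> x y = - entry \<mu> y x"
  by (cases x; cases y) (simp_all flip: assms)

text \<open>Expansion along \<open>Z\<close> after moving it to the front. It passes an odd number
  of labels, and the resulting sign cancels the one in \<open>entry \<mu> Z (Idx i)\<close>.\<close>

lemma Pf_entry_Z:
  assumes skew: "\<And>i j. \<mu> i j = - \<mu> j i" and "odd (length xs)"
  shows "Pf (entry \<mu>) (map Idx xs @ [Z]) =
    (\<Sum>j<length xs. monom ((-1) ^ j * Pf \<mu> (drop_nth j xs)) (xs ! j))"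
proof -
  note skew_entry = entry_skew[where \<mu> = \<mu>, OF skew]
  have "Pf (entry \<mu>) (Z # map Idx xs) = - Pf (entry \<mu>) (map Idx xs @ [Z])"
    using Pf_move_front[where e = "entry \<mu>", OF skew_entry, of Z "map Idx xs" "[]"] assms(2) by simp
  moreover have "Pf (entry \<mu>) (Z # map Idx xs) =
     - (\<Sum>j<length xs. monom ((-1) ^ j * Pf \<mu> (drop_nth j xs)) (xs ! j))"
    unfolding Pf_Cons sum_negf[symmetric]
  proof (rule sum.cong)
    fix j assume "j \<in> {..<length xs}"
    then show "(-1) ^ j * entry \<mu> Z (map Idx xs ! j) * Pf (entry \<mu>) (drop_nth j (map Idx xs)) =
      - monom ((-1) ^ j * Pf \<mu> (drop_nth j xs)) (xs ! j)"
      by (simp add: drop_nth_map Pf_entry_Idx smult_monom minus_one_power_poly mult.commute)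
  qed simp
  ultimately show ?thesis by simp
qed

text \<open>Makes the \<open>div\<close> in the definition of \<open>P\<close> exact.\<close>

lemma monom_dvd_Pf_entry_Z:
  assumes skew: "\<And>i j. \<mu> i j = - \<mu> j i" and "odd (length xs)" "\<forall>x\<in>set xs. m \<le> x"
  shows "monom 1 m dvd Pf (entry \<mu>) (map Idx xs @ [Z])"
  unfolding Pf_entry_Z[where \<mu> = \<mu>, OF assms(1,2)]
proof (rule dvd_sum)
  fix j assume "j \<in> {..<length xs}"
  then have "m \<le> xs ! j" using assms(3) by simp
  then have "monom c (xs ! j) = monom 1 m * monom c (xs ! j - m)" for c :: real
    by (simp add: mult_monom)
  then show "monom 1 m dvd monom ((-1) ^ j * Pf \<mu> (drop_nth j xs)) (xs ! j)"
    by (metis dvd_triv_left)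
qed

text \<open>Only the term that strikes \<open>m\<close> contributes to \<open>z^m\<close>. This
  yields the values of the polynomials at 0.\<close>

lemma coeff_Pf_entry_Z:
  assumes skew: "\<And>i j. \<mu> i j = - \<mu> j i" and "even (length xs)" "m \<notin> set xs"
  shows "coeff (Pf (entry \<mu>) (map Idx (m # xs) @ [Z])) m = Pf \<mu> xs"
proof -
  have "xs ! j \<noteq> m" if "j < length xs" for j using that assms(3) by auto
  then show ?thesis
    using Pf_entry_Z[where \<mu> = \<mu>, OF skew, where xs = "m # xs"] assms(2)
    by (simp add: sum.lessThan_Suc_shift coeff_sum drop_nth_Cons del: sum.lessThan_Suc)
qed

lemma tau_eq: "\<tau> \<mu> m (2 * int n) = Pf \<mu> [m..<m + 2 * n]"
proof -
  have "nat (2 * int n) = 2 * n" by simp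
  then show ?thesis by (simp add: \<tau>_def)
qed

lemma poly_0_eq_coeff_monom_mult: "poly p 0 = coeff (monom 1 m * p) m" for p :: "real poly"
  by (simp add: coeff_monom_mult poly_0_coeff_0)

context
  fixes \<mu> :: "nat \<Rightarrow> nat \<Rightarrow> real"
  assumes skew: "\<And>i j. \<mu> i j = - \<mu> j i"
begin

lemma monom_mult_P_even:
  "monom 1 m * P \<mu> m (2 * int n) =
     smult (1 / \<tau> \<mu> m (2 * int n)) (Pf (entry \<mu>) (map Idx [m..<m + 2 * n + 1] @ [Z]))"
proof -
  have "nat (2 * int n) = 2 * n" by simp
  moreover have "monom 1 m dvd Pf (entry \<mu>) (map Idx [m..<m + 2 * n + 1] @ [Z])"
    by (rule monom_dvd_Pf_entry_Z[where \<mu> = \<mu>, OF skew]) auto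
  ultimately show ?thesis by (simp add: P_def Let_def del: upt_Suc)
qed

lemma monom_mult_P_odd:
  "monom 1 m * P \<mu> m (2 * int n + 1) =
     smult (1 / \<tau> \<mu> m (2 * int n)) (Pf (entry \<mu>) (map Idx ([m..<m + 2 * n] @ [m + 2 * n + 1]) @ [Z]))"
proof -
  have "nat (2 * int n + 1) = 2 * n + 1" by simp
  moreover have "monom 1 m dvd Pf (entry \<mu>) (map Idx ([m..<m + 2 * n] @ [m + 2 * n + 1]) @ [Z])"
    by (rule monom_dvd_Pf_entry_Z[where \<mu> = \<mu>, OF skew]) auto
  ultimately show ?thesis by (simp add: P_def Let_def del: upt_Suc)
qed

lemma poly_P_even_0:
  "poly (P \<mu> m (2 * int n)) 0 = \<tau> \<mu> (Suc m) (2 * int n) / \<tau> \<mu> m (2 * int n)"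
proof -
  have "[m..<m + 2 * n + 1] = m # [Suc m..<Suc m + 2 * n]"
    by (simp add: upt_conv_Cons)
  then show ?thesis
    unfolding poly_0_eq_coeff_monom_mult[of _ m] monom_mult_P_even tau_eq[of \<mu> "Suc m"]
    by (simp only: coeff_smult) (subst coeff_Pf_entry_Z[where \<mu> = \<mu>, OF skew]; simp)
qed

text \<open>Stated from \<open>Suc n\<close> on: for subscript 1 the label list is
  \<open>[m + 1]\<close>, which has no leading \<open>m\<close> to strike.\<close>

lemma poly_P_odd_0:
  "poly (P \<mu> m (2 * int (Suc n) + 1)) 0 =
     Pf \<mu> ([Suc m..<Suc m + 2 * n + 1] @ [m + 2 * n + 3]) / \<tau> \<mu> m (2 * int (Suc n))"
proof -
  have "[m..<m + 2 * Suc n] @ [m + 2 * Suc n + 1] = m # ([Suc m..<Suc m + 2 * n + 1] @ [m + 2 * n + 3])"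
    by (simp add: upt_conv_Cons)
  then show ?thesis
    unfolding poly_0_eq_coeff_monom_mult[of _ m] monom_mult_P_odd
    by (simp only: coeff_smult) (subst coeff_Pf_entry_Z[where \<mu> = \<mu>, OF skew]; simp)
qed

end

section \<open>The two recurrences\<close>

lemma monom_mult_cancel: "monom 1 m * p = monom 1 m * q \<Longrightarrow> p = q" for p :: "'a::idom poly"
  by (subst (asm) mult_left_cancel) simp_all

text \<open>The factor \<open>z\<close> in the recurrences accounts for the passage from
  \<open>z^m\<close> to \<open>z^(m+1)\<close> in the normalization of the next family.\<close>

lemma monom_mult_shift: "monom 1 m * ([:0, 1:] * p) = monom 1 (m + 1) * p" for p :: "'a::comm_ring_1 poly"
  by (simp add: monom_Suc)

context
  fixes \<mu> :: "nat \<Rightarrow> nat \<Rightarrow> real"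
  assumes skew: "\<And>i j. \<mu> i j = - \<mu> j i"
    and tau_nonzero: "\<And>n m :: nat. \<tau> \<mu> m (2 * int n) \<noteq> 0"
begin

lemma P_relation_odd:
  "P \<mu> m (2 * int n + 1) - smult (coeff_A \<mu> m n) (P \<mu> m (2 * int n))
    = [:0, 1:] * (P \<mu> (m + 1) (2 * int n) - smult (coeff_B \<mu> m n) (P \<mu> (m + 1) (2 * int n - 2)))"
proof (cases n)
  \<comment> \<open>Here \<open>[m..<m + 2 * n]\<close> is empty and cannot be split as
    \<open>m # S\<close>. Both sides equal \<open>z\<close>: \<open>coeff_A\<close> is 0, and the
    polynomial with subscript -2 is 0 by convention.\<close>
  case 0
  have tau_0: "\<tau> \<mu> k 0 = 1" for k by (simp add: \<tau>_def)
  have P_0: "P \<mu> k 0 = 1" for k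
    using monom_mult_P_even[where \<mu> = \<mu>, OF skew, of k 0] by (simp add: tau_0 Pf_Cons drop_nth_def)
  have "monom 1 m * P \<mu> m 1 = monom 1 m * [:0, 1:]"
    using monom_mult_P_odd[where \<mu> = \<mu>, OF skew, of m 0]
    by (simp add: tau_0 Pf_Cons drop_nth_def monom_Suc)
  then have P_1: "P \<mu> m 1 = [:0, 1:]"
    by (rule monom_mult_cancel)
  have "P \<mu> (m + 1) (- 2) = 0" by (simp add: P_def)
  with 0 show ?thesis by (simp add: coeff_A_def P_0 P_1)
next
  case (Suc k)
  define S where "S = [m + 1..<m + 2 * n]"
  let ?Q = "\<lambda>xs. Pf (entry \<mu>) (map Idx xs @ [Z])"
  let ?x = "m + 2 * n" and ?y = "m + 2 * n + 1"
  have lists: "[m..<m + 2 * n] = m # S" "[m..<m + 2 * n + 1] = m # S @ [?x]"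
    "[m + 1..<m + 1 + 2 * n] = S @ [?x]" "[m + 1..<m + 1 + 2 * n + 1] = S @ [?x, ?y]"
    "[m + 1..<m + 1 + 2 * k + 1] = S" "[m..<m + 2 * Suc n] = m # S @ [?x, ?y]"
    "[Suc m..<Suc m + 2 * k + 1] = S" "m + 2 * k + 3 = ?y"
    by (simp_all add: S_def Suc upt_conv_Cons)
  have idx: "2 * int n - 2 = 2 * int k" "2 * int n + 2 = 2 * int (Suc n)" by (simp_all add: Suc)
  \<comment> \<open>The constants \<open>t\<close>, \<open>a\<close>, \<open>d\<close> normalize the
    polynomials involved; \<open>b\<close> and \<open>c\<close> are the remaining Pfaffians without
    \<open>z\<close> in the Pluecker relation.\<close>
  define t a b c d where "t = \<tau> \<mu> m (2 * int n)" and "a = \<tau> \<mu> (m + 1) (2 * int n)"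
    and "b = Pf \<mu> (S @ [?y])" and "c = \<tau> \<mu> m (2 * int (Suc n))" and "d = \<tau> \<mu> (m + 1) (2 * int k)"
  have nz: "t \<noteq> 0" "a \<noteq> 0" "d \<noteq> 0" using tau_nonzero by (simp_all add: t_def a_def d_def)
  have taus: "t = Pf \<mu> (m # S)" "a = Pf \<mu> (S @ [?x])" "c = Pf \<mu> (m # S @ [?x, ?y])"
    by (simp_all only: t_def a_def c_def tau_eq lists)
  have A: "coeff_A \<mu> m n = b / a"
    using nz poly_P_odd_0[where \<mu> = \<mu>, OF skew, of m k, unfolded lists, folded Suc b_def t_def]
      poly_P_even_0[where \<mu> = \<mu>, OF skew, of m n]
    by (simp add: coeff_A_def t_def a_def)
  have B: "coeff_B \<mu> m n = c * d / (t * a)"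
    by (simp add: coeff_B_def idx t_def a_def c_def d_def)
  have "odd (length S)" by (simp add: S_def Suc)
  from Pf_identity_odd[where e = "entry \<mu>", OF entry_skew[where \<mu> = \<mu>, OF skew], of "map Idx S" "Idx ?x" "Idx m" "Idx ?y" Z]
  have "smult a (?Q (m # S @ [?y])) - smult b (?Q (m # S @ [?x]))
    = smult t (?Q (S @ [?x, ?y])) - smult c (?Q S)"
    using \<open>odd (length S)\<close> Pf_entry_Idx[of \<mu> "S @ [?x]"] Pf_entry_Idx[of \<mu> "S @ [?y]"]
      Pf_entry_Idx[of \<mu> "m # S"] Pf_entry_Idx[of \<mu> "m # S @ [?x, ?y]"]
    by (simp add: taus b_def)
  then have "a * coeff (?Q (m # S @ [?y])) i - b * coeff (?Q (m # S @ [?x])) i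
    = t * coeff (?Q (S @ [?x, ?y])) i - c * coeff (?Q S) i" for i
    by (metis coeff_diff coeff_smult)
  \<comment> \<open>Division by \<open>t * a\<close>. The \<open>d\<close> in the last coefficient
    cancels against the normalization of \<open>?Q S\<close>.\<close>
  then have "smult (1 / t) (?Q (m # S @ [?y])) - smult (b / a) (smult (1 / t) (?Q (m # S @ [?x]))) =
    smult (1 / a) (?Q (S @ [?x, ?y])) - smult (c * d / (t * a)) (smult (1 / d) (?Q S))"
    using nz by (intro poly_eqI) (simp add: field_simps)
  moreover have "monom 1 m * P \<mu> m (2 * int n + 1) = smult (1 / t) (?Q (m # S @ [?y]))"
    "monom 1 m * P \<mu> m (2 * int n) = smult (1 / t) (?Q (m # S @ [?x]))"
    "monom 1 (m + 1) * P \<mu> (m + 1) (2 * int n) = smult (1 / a) (?Q (S @ [?x, ?y]))"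
    "monom 1 (m + 1) * P \<mu> (m + 1) (2 * int k) = smult (1 / d) (?Q S)"
    unfolding monom_mult_P_even[where \<mu> = \<mu>, OF skew] monom_mult_P_odd[where \<mu> = \<mu>, OF skew] lists
    by (simp_all add: t_def a_def d_def)
  ultimately have "monom 1 m * (P \<mu> m (2 * int n + 1) - smult (coeff_A \<mu> m n) (P \<mu> m (2 * int n))) =
    monom 1 m * ([:0, 1:] * (P \<mu> (m + 1) (2 * int n) - smult (coeff_B \<mu> m n) (P \<mu> (m + 1) (2 * int n - 2))))"
    unfolding monom_mult_shift right_diff_distrib mult_smult_right A B idx(1) by simp
  then show ?thesis by (rule monom_mult_cancel)
qed

text \<open>Removes the case distinction at \<open>m = 0\<close>. For positive \<open>m\<close> the
  two values at 0 share the denominator \<open>\<tau> \<mu> (m - 1) (2 * int n + 2)\<close>, which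
  cancels.\<close>

lemma coeff_D_eq:
  "coeff_D \<mu> m n = Pf \<mu> ([m..<m + 2 * n + 1] @ [m + 2 * n + 2]) / \<tau> \<mu> m (2 * int (Suc n))"
proof (cases m)
  case 0
  then show ?thesis by (simp add: coeff_D_def add.commute del: upt_Suc)
next
  case (Suc k)
  have idx: "2 * int n + 3 = 2 * int (Suc n) + 1" "2 * int n + 2 = 2 * int (Suc n)" by simp_all
  have "\<tau> \<mu> k (2 * int (Suc n)) \<noteq> 0" by (rule tau_nonzero)
  then show ?thesis
    unfolding coeff_D_def idx using Suc poly_P_odd_0[where \<mu> = \<mu>, OF skew, of k n]
      poly_P_even_0[where \<mu> = \<mu>, OF skew, of k "Suc n"]
    by (simp add: numeral_3_eq_3 del: of_nat_Suc upt_Suc)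
qed

lemma P_relation_even:
  "P \<mu> m (2 * int n + 2) - smult (coeff_C \<mu> m n) (P \<mu> m (2 * int n))
    = [:0, 1:] * (P \<mu> (m + 1) (2 * int n + 1) - smult (coeff_D \<mu> m n) (P \<mu> (m + 1) (2 * int n)))"
proof -
  \<comment> \<open>For \<open>n = 0\<close> this list is empty and the splittings below still hold,
    so one argument covers all \<open>n\<close>.\<close>
  define S where "S = [m + 1..<m + 2 * n + 1]"
  let ?Q = "\<lambda>xs. Pf (entry \<mu>) (map Idx xs @ [Z])"
  let ?x = "m + 2 * n + 1" and ?y = "m + 2 * n + 2"
  have lists: "[m..<m + 2 * n + 1] = m # S" "[m..<m + 2 * Suc n + 1] = m # S @ [?x, ?y]"
    "[m + 1..<?y] = S @ [?x]" "[m + 1..<m + 1 + 2 * n] = S" "m + 1 + 2 * n + 1 = ?y"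
    "[m..<m + 2 * Suc n] = m # S @ [?x]" "[m + 1..<m + 1 + 2 * Suc n] = S @ [?x, ?y]"
    by (simp_all add: S_def upt_conv_Cons)
  have idx: "2 * int n + 2 = 2 * int (Suc n)" by simp
  define t u a b d where "t = \<tau> \<mu> m (2 * int n)" and "u = \<tau> \<mu> m (2 * int (Suc n))"
    and "a = \<tau> \<mu> (m + 1) (2 * int n)" and "b = \<tau> \<mu> (m + 1) (2 * int (Suc n))" and "d = Pf \<mu> (m # S @ [?y])"
  have nz: "t \<noteq> 0" "u \<noteq> 0" "a \<noteq> 0" using tau_nonzero by (simp_all add: t_def u_def a_def del: of_nat_Suc)
  have taus: "u = Pf \<mu> (m # S @ [?x])" "a = Pf \<mu> S" "b = Pf \<mu> (S @ [?x, ?y])"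
    by (simp_all only: u_def a_def b_def tau_eq lists)
  have C: "coeff_C \<mu> m n = t * b / (u * a)"
    by (simp add: coeff_C_def idx t_def u_def a_def b_def)
  have D: "coeff_D \<mu> m n = d / u"
    unfolding coeff_D_eq lists u_def d_def by simp
  have "even (length S)" by (simp add: S_def)
  from Pf_identity_even[where e = "entry \<mu>", OF entry_skew[where \<mu> = \<mu>, OF skew], of "map Idx S" "Idx m" "Idx ?x" "Idx ?y" Z]
  have "smult a (?Q (m # S @ [?x, ?y])) - smult b (?Q (m # S))
    = smult u (?Q (S @ [?y])) - smult d (?Q (S @ [?x]))"
    using \<open>even (length S)\<close> Pf_entry_Idx[of \<mu> "S"] Pf_entry_Idx[of \<mu> "m # S @ [?x]"]
      Pf_entry_Idx[of \<mu> "m # S @ [?y]"] Pf_entry_Idx[of \<mu> "S @ [?x, ?y]"]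
    by (simp add: taus d_def)
  then have "a * coeff (?Q (m # S @ [?x, ?y])) i - b * coeff (?Q (m # S)) i
    = u * coeff (?Q (S @ [?y])) i - d * coeff (?Q (S @ [?x])) i" for i
    by (metis coeff_diff coeff_smult)
  \<comment> \<open>Division by \<open>u * a\<close>. The \<open>t\<close> in the coefficient of the
    second term cancels against the normalization of \<open>?Q (m # S)\<close>.\<close>
  then have "smult (1 / u) (?Q (m # S @ [?x, ?y])) - smult (t * b / (u * a)) (smult (1 / t) (?Q (m # S))) =
    smult (1 / a) (?Q (S @ [?y])) - smult (d / u) (smult (1 / a) (?Q (S @ [?x])))"
    using nz by (intro poly_eqI) (simp add: field_simps)
  moreover have "monom 1 m * P \<mu> m (2 * int (Suc n)) = smult (1 / u) (?Q (m # S @ [?x, ?y]))"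
    "monom 1 m * P \<mu> m (2 * int n) = smult (1 / t) (?Q (m # S))"
    "monom 1 (m + 1) * P \<mu> (m + 1) (2 * int n + 1) = smult (1 / a) (?Q (S @ [?y]))"
    "monom 1 (m + 1) * P \<mu> (m + 1) (2 * int n) = smult (1 / a) (?Q (S @ [?x]))"
    unfolding monom_mult_P_even[where \<mu> = \<mu>, OF skew] monom_mult_P_odd[where \<mu> = \<mu>, OF skew] lists
    by (simp_all add: t_def a_def u_def)
  ultimately have "monom 1 m * (P \<mu> m (2 * int (Suc n)) - smult (coeff_C \<mu> m n) (P \<mu> m (2 * int n))) =
    monom 1 m * ([:0, 1:] * (P \<mu> (m + 1) (2 * int n + 1) - smult (coeff_D \<mu> m n) (P \<mu> (m + 1) (2 * int n))))"
    unfolding monom_mult_shift right_diff_distrib mult_smult_right C D by simp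
  then show ?thesis unfolding idx by (rule monom_mult_cancel)
qed

end

theorem proposition2p2:
  fixes \<mu> :: "nat \<Rightarrow> nat \<Rightarrow> real"
  assumes skew: "\<And>i j. \<mu> i j = - \<mu> j i"
    and tau_nonzero: "\<And>n m :: nat. \<tau> \<mu> m (2 * int n) \<noteq> 0"
  shows "\<forall>n m :: nat.
     P \<mu> m (2 * int n + 1) - smult (coeff_A \<mu> m n) (P \<mu> m (2 * int n))
       = [:0, 1:] * (P \<mu> (m + 1) (2 * int n) - smult (coeff_B \<mu> m n) (P \<mu> (m + 1) (2 * int n - 2))) \<and>
     P \<mu> m (2 * int n + 2) - smult (coeff_C \<mu> m n) (P \<mu> m (2 * int n))
       = [:0, 1:] * (P \<mu> (m + 1) (2 * int n + 1) - smult (coeff_D \<mu> m n) (P \<mu> (m + 1) (2 * int n)))"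
  using P_relation_odd[where \<mu> = \<mu>, OF skew tau_nonzero] P_relation_even[where \<mu> = \<mu>, OF skew tau_nonzero]
  by (intro allI conjI)

end
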